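(* Let $X$ be a linearly ordered set with $|X|\geq 5$. Then there exists no weak order $\succeq$ on $\mathcal{X}=2^X\setminus\{\emptyset\}$ satisfying strict independence (strictIND), simple uncertainty aversion (SUAv) and monotone consistency (MC).
   Context: $X$ is linearly ordered by $\dot{\geq}$ (reflexive, complete, transitive, antisymmetric), with strict part $x\mathrel{\dot{>}}y$ iff $x\mathrel{\dot{\geq}}y$ and not $y\mathrel{\dot{\geq}}x$. $\mathcal{X}=2^X\setminus\{\emptyset\}$ is the set of nonempty subsets of $X$. A weak order is a reflexive, complete and transitive binary relation. For a binary relation $\succeq$ on $\mathcal{X}$, $A\succ B$ means $A\succeq B$ and not $B\succeq A$. The axioms are: - (strictIND) for all $A,B\in\mathcal{X}$ and all $x\in X\setminus(A\cup B)$: $A\succ B$ implies $A\cup\{x\}\succ B\cup\{x\}$. - (SUAv) for all $x,y,z\in X$: $x\mathrel{\dot{>}}y$ and $y\mathrel{\dot{>}}z$ imply $\{y\}\succ\{x,z\}$. - (MC) for all $A,B\in\mathcal{X}$: $A\succeq B$ implies $A\cup B\succeq B$. *)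

theory Defs
  imports Main
begin

text \<open>A relation is a set of pairs, and \<open>(a, b) \<in> r\<close> is read as ``a is at least as good as b''.\<close>

definition strictly :: "'a rel \<Rightarrow> 'a \<Rightarrow> 'a \<Rightarrow> bool" where
  "strictly r a b \<longleftrightarrow> (a, b) \<in> r \<and> (b, a) \<notin> r"

definition nonempty_subsets :: "'a set \<Rightarrow> 'a set set" where
  "nonempty_subsets X = Pow X - {{}}"

text \<open>\<open>total_on\<close> only compares distinct elements; with the reflexivity contained in
  \<open>preorder_on\<close> it is completeness. \<open>preorder_on\<close> also contains \<open>r \<subseteq> S \<times> S\<close>.\<close>

definition weak_order_on :: "'a set \<Rightarrow> 'a rel \<Rightarrow> bool" where
  "weak_order_on S r \<longleftrightarrow> preorder_on S r \<and> total_on S r"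

definition strictIND :: "'a set \<Rightarrow> 'a set rel \<Rightarrow> bool" where
  "strictIND X R \<longleftrightarrow>
    (\<forall>A \<in> nonempty_subsets X. \<forall>B \<in> nonempty_subsets X. \<forall>x \<in> X - (A \<union> B).
       strictly R A B \<longrightarrow> strictly R (A \<union> {x}) (B \<union> {x}))"

definition SUAv :: "'a set \<Rightarrow> 'a rel \<Rightarrow> 'a set rel \<Rightarrow> bool" where
  "SUAv X r R \<longleftrightarrow>
    (\<forall>x \<in> X. \<forall>y \<in> X. \<forall>z \<in> X.
       strictly r x y \<and> strictly r y z \<longrightarrow> strictly R {y} {x, z})"

definition MC :: "'a set \<Rightarrow> 'a set rel \<Rightarrow> bool" where
  "MC X R \<longleftrightarrow>
    (\<forall>A \<in> nonempty_subsets X. \<forall>B \<in> nonempty_subsets X.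
       (A, B) \<in> R \<longrightarrow> (A \<union> B, B) \<in> R)"

end

theory Submission
  imports Defs
begin

text \<open>Five elements \<open>a, b, c, d, e\<close> in decreasing order suffice. Simple uncertainty aversion and
  strict independence give \<open>{b,e} \<succ> {a,c,e} \<succ> {a,b,d,e}\<close>. By monotone consistency
  \<open>{a,b,d} \<succeq> {b,e}\<close> would yield \<open>{a,b,d,e} \<succeq> {b,e}\<close>, hence \<open>{b,e} \<succ> {a,b,d}\<close> and so
  \<open>{a,b,d,e} \<succeq> {a,b,d}\<close>. Since \<open>{b} \<succ> {a,d}\<close> gives \<open>{a,b,d} \<succeq> {a,d}\<close>, and \<open>{d} \<succ> {c,e}\<close> gives
  \<open>{a,d} \<succ> {a,c,e}\<close>, this closes the cycle
  \<open>{a,c,e} \<succ> {a,b,d,e} \<succeq> {a,b,d} \<succeq> {a,d} \<succ> {a,c,e}\<close>.\<close>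

lemma strictly_linear_order:
  assumes "linear_order_on X r"
  shows strictly_irrefl: "\<not> strictly r x x"
    and strictly_trans: "strictly r x y \<Longrightarrow> strictly r y z \<Longrightarrow> strictly r x z"
    and strictly_total: "x \<in> X \<Longrightarrow> y \<in> X \<Longrightarrow> x \<noteq> y \<Longrightarrow> strictly r x y \<or> strictly r y x"
  using assms
  unfolding strictly_def linear_order_on_def partial_order_on_def preorder_on_def
    trans_def antisym_def total_on_def
  by blast+

text \<open>Insertion sort: a new element goes between the entries above it and those below it.
  Totality puts every old entry on one side, and transitivity through the new element orders the two
  sides.\<close>

lemma sorted_enumeration:
  assumes r: "linear_order_on X r" and "finite Y" "Y \<subseteq> X"
  shows "\<exists>xs. sorted_wrt (strictly r) xs \<and> set xs = Y"
  using assms(2,3)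
proof (induction Y)
  case empty
  then show ?case by simp
next
  case (insert a Y)
  then obtain xs where xs: "sorted_wrt (strictly r) xs" "set xs = Y" by auto
  let ?ys = "filter (\<lambda>x. strictly r x a) xs @ a # filter (strictly r a) xs"
  have "sorted_wrt (strictly r) ?ys"
    using xs strictly_trans[OF r] by (auto simp: sorted_wrt_append sorted_wrt_filter)
  moreover have "set ?ys = insert a Y"
    using insert.prems insert.hyps xs strictly_total[OF r, of _ a] by auto
  ultimately show ?case by blast
qed

lemma no_order_on_five:
  assumes X: "a \<in> X" "b \<in> X" "c \<in> X" "d \<in> X" "e \<in> X"
    and distinct: "distinct [a, b, c, d, e]"
    and sorted: "sorted_wrt (strictly r) [a, b, c, d, e]"
    and weak: "weak_order_on (nonempty_subsets X) R"
    and ind: "strictIND X R" and suav: "SUAv X r R" and mc: "MC X R"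
  shows False
proof -
  have trans: "(A, C) \<in> R" if "(A, B) \<in> R" "(B, C) \<in> R" for A B C
    using weak that unfolding weak_order_on_def preorder_on_def trans_def by blast
  have total: "(A, B) \<in> R \<or> (B, A) \<in> R"
    if "A \<in> nonempty_subsets X" "B \<in> nonempty_subsets X" for A B
    using weak that unfolding weak_order_on_def preorder_on_def refl_on_def total_on_def by metis
  have add: "strictly R (insert x A) (insert x B)"
    if "strictly R A B" "A \<in> nonempty_subsets X" "B \<in> nonempty_subsets X"
      "x \<in> X" "x \<notin> A" "x \<notin> B" for x A B
    using ind that unfolding strictIND_def by simp
  have averse: "strictly R {y} {x, z}"
    if "strictly r x y" "strictly r y z" "x \<in> X" "y \<in> X" "z \<in> X" for x y z
    using suav that unfolding SUAv_def by blast
  have mono: "(A \<union> B, B) \<in> R"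
    if "(A, B) \<in> R" "A \<in> nonempty_subsets X" "B \<in> nonempty_subsets X" for A B
    using mc that unfolding MC_def by blast
  have ne: "A \<in> nonempty_subsets X" if "A \<subseteq> X" "A \<noteq> {}" for A
    using that unfolding nonempty_subsets_def by blast
  have b_ac: "strictly R {b} {a, c}" and b_ad: "strictly R {b} {a, d}"
    and c_bd: "strictly R {c} {b, d}" and d_ce: "strictly R {d} {c, e}"
    using sorted X by (auto intro!: averse)
  \<comment> \<open>The added element is listed first, the shape that \<open>add\<close>
    produces.\<close>
  have be_ace: "strictly R {e, b} {e, a, c}"
    using add[OF b_ac] X distinct by (auto simp: ne)
  have ac_abd: "strictly R {a, c} {a, b, d}"
    using add[OF c_bd] X distinct by (auto simp: ne)
  have ace_abde: "strictly R {e, a, c} {e, a, b, d}"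
    using add[OF ac_abd] X distinct by (auto simp: ne)
  have ad_ace: "strictly R {a, d} {a, c, e}"
    using add[OF d_ce] X distinct by (auto simp: ne)
  have abd_ad: "({a, b, d}, {a, d}) \<in> R"
    using mono[of "{b}" "{a, d}"] b_ad X by (auto simp: ne strictly_def insert_commute)
  \<comment> \<open>Otherwise \<open>{e, a, c}\<close> would be at least as good as
    \<open>{e, b}\<close>, against \<open>be_ace\<close>.\<close>
  have "({e, a, b, d}, {e, b}) \<notin> R"
    using be_ace ace_abde trans unfolding strictly_def by blast
  moreover have "{a, b, d} \<union> {e, b} = {e, a, b, d}" "{e, b} \<union> {a, b, d} = {e, a, b, d}"
    by auto
  \<comment> \<open>Completeness compares \<open>{a, b, d}\<close> with \<open>{e, b}\<close>. Their
    union is the same in either order, so one alternative gives the relation just excluded and the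
    other gives the claim.\<close>
  ultimately have abde_abd: "({e, a, b, d}, {a, b, d}) \<in> R"
    using mono[of "{a, b, d}" "{e, b}"] mono[of "{e, b}" "{a, b, d}"]
      total[of "{a, b, d}" "{e, b}"] X ne by auto
  have "{e, a, c} = {a, c, e}" by auto
  then show False
    using ace_abde abde_abd abd_ad ad_ace trans unfolding strictly_def by metis
qed

theorem theorem7:
  fixes X :: "'a set" and r :: "'a rel"
  assumes "linear_order_on X r"
    and "infinite X \<or> card X \<ge> 5"
  shows "\<nexists>R :: 'a set rel.
    weak_order_on (nonempty_subsets X) R \<and> strictIND X R \<and> SUAv X r R \<and> MC X R"
proof -
  \<comment> \<open>\<open>card\<close> is 0 on infinite sets, so the infinite case is separate;
    both cases yield five elements.\<close>
  obtain Y where Y: "Y \<subseteq> X" "card Y = 5" "finite Y"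
    using assms(2) obtain_subset_with_card_n infinite_arbitrarily_large by metis
  obtain xs where xs: "sorted_wrt (strictly r) xs" "set xs = Y"
    using sorted_enumeration[OF assms(1) Y(3,1)] by blast
  \<comment> \<open>A repeated entry would lie strictly above itself.\<close>
  have "distinct xs"
    using xs(1) by (induction xs) (auto simp: strictly_irrefl[OF assms(1)])
  then have "length xs = 5"
    using xs(2) Y(2) distinct_card by metis
  then obtain a b c d e where "xs = [a, b, c, d, e]"
    by (auto simp: numeral_eq_Suc length_Suc_conv)
  then show ?thesis
    using no_order_on_five[of a X b c d e r] xs Y(1) \<open>distinct xs\<close> by auto
qed

end
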